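(* Let $1\le t\le n$ and $L,R>0$. (a) There exist a convex function $f:\mathbb{R}^n\to\mathbb{R}$ that is $L$-Lipschitz on $\mathrm{B}_2(R)$, and a first order oracle for $f$, such that for any black-box procedure satisfying the span condition, $$\min_{1\le s\le t}f(x_s)-\min_{x\in\mathrm{B}_2(R)}f(x)\ge\frac{RL}{2(1+\sqrt t)}.$$ (b) For every $\alpha>0$ there also exist an $\alpha$-strongly convex function $f:\mathbb{R}^n\to\mathbb{R}$ that is $L$-Lipschitz on $\mathrm{B}_2\left(\frac{L}{2\alpha}\right)$, and a first order oracle for $f$, such that for any black-box procedure satisfying the span condition, $$\min_{1\le s\le t}f(x_s)-\min_{x\in\mathrm{B}_2\left(\frac{L}{2\alpha}\right)}f(x)\ge\frac{L^2}{8\alpha t}.$$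
   Context: $\|\cdot\|$ is the Euclidean norm, $\mathrm{B}_2(\rho)=\{x\in\mathbb{R}^n:\|x\|\le\rho\}$. $\partial f(x)=\{g: f(x)-f(y)\le g^\top(x-y)\ \forall y\in\mathbb{R}^n\}$. $f$ is $L$-Lipschitz on a set if $\|g\|\le L$ for every $x$ in the set and $g\in\partial f(x)$. $f$ is $\alpha$-strongly convex if $f(x)-f(y)\le g^\top(x-y)-\frac\alpha2\|x-y\|^2$ for all $x,y$ and $g\in\partial f(x)$. A first order oracle for $f$ is a map assigning to each $x\in\mathbb{R}^n$ an element of $\partial f(x)$. A black-box procedure maps the history $(x_1,g_1,\dots,x_s,g_s)$, where $g_j\in\partial f(x_j)$ is the oracle's answer at $x_j$, to the next query point $x_{s+1}$. The span condition is: $x_1=0$ and $x_{s+1}\in\mathrm{Span}(g_1,\dots,g_s)$ for every $s\ge 1$. *)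

theory Defs
  imports "HOL-Analysis.Analysis"
begin

definition subdifferential :: "('a::real_inner \<Rightarrow> real) \<Rightarrow> 'a \<Rightarrow> 'a set" where
  "subdifferential f x = {g. \<forall>y. f x - f y \<le> g \<bullet> (x - y)}"

text \<open>
  Lipschitz continuity is understood through subgradients, which differs in
  general from \<open>lipschitz_on\<close>: at a boundary point of \<open>X\<close> the subgradients also
  depend on the values of \<open>f\<close> outside \<open>X\<close>.
\<close>

definition subgradient_lipschitz_on :: "real \<Rightarrow> ('a::real_inner) set \<Rightarrow> ('a \<Rightarrow> real) \<Rightarrow> bool" where
  "subgradient_lipschitz_on L X f \<longleftrightarrow> (\<forall>x\<in>X. \<forall>g\<in>subdifferential f x. norm g \<le> L)"

text \<open>
  This constrains \<open>f\<close> only at points having a subgradient; it implies convexity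
  when every subdifferential is nonempty, in particular when \<open>f\<close> has a first
  order oracle.
\<close>

definition strongly_convex :: "real \<Rightarrow> ('a::real_inner \<Rightarrow> real) \<Rightarrow> bool" where
  "strongly_convex \<alpha> f \<longleftrightarrow>
     (\<forall>x y. \<forall>g\<in>subdifferential f x. f x - f y \<le> g \<bullet> (x - y) - \<alpha> / 2 * (norm (x - y))\<^sup>2)"

definition first_order_oracle :: "('a::real_inner \<Rightarrow> real) \<Rightarrow> ('a \<Rightarrow> 'a) \<Rightarrow> bool" where
  "first_order_oracle f orc \<longleftrightarrow> (\<forall>x. orc x \<in> subdifferential f x)"

text \<open>
  A black-box procedure maps the history \<open>[(x\<^sub>1, g\<^sub>1), \<dots>, (x\<^sub>s, g\<^sub>s)]\<close> to the next
  query point; the first query point is its value on the empty history.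
\<close>

type_synonym 'a black_box = "('a \<times> 'a) list \<Rightarrow> 'a"

primrec history :: "'a black_box \<Rightarrow> ('a \<Rightarrow> 'a) \<Rightarrow> nat \<Rightarrow> ('a \<times> 'a) list" where
  "history A orc 0 = []"
| "history A orc (Suc s) =
     history A orc s @ [(A (history A orc s), orc (A (history A orc s)))]"

text \<open>Queries are numbered from 1; \<open>query A orc 0\<close> has no meaning.\<close>

definition query :: "'a black_box \<Rightarrow> ('a \<Rightarrow> 'a) \<Rightarrow> nat \<Rightarrow> 'a" where
  "query A orc s = A (history A orc (s - 1))"

text \<open>The condition concerns only the run of \<open>A\<close> against the oracle \<open>orc\<close>.\<close>

definition span_condition :: "('a::real_vector) black_box \<Rightarrow> ('a \<Rightarrow> 'a) \<Rightarrow> bool" where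
  "span_condition A orc \<longleftrightarrow>
     query A orc 1 = 0 \<and>
     (\<forall>s\<ge>1. query A orc (s + 1) \<in> span ((\<lambda>j. orc (query A orc j)) ` {1..s}))"

end

theory Submission
  imports Defs
begin

text \<open>
  Both parts use one function. For orthonormal vectors \<open>e\<^sub>1, \<dots>, e\<^sub>t\<close> and
  \<open>\<gamma>, \<alpha> > 0\<close> let \<open>f x = \<gamma> max\<^sub>i (e\<^sub>i \<bullet> x) + \<alpha>/2 \<parallel>x\<parallel>\<^sup>2\<close>, and let the oracle answer
  \<open>\<alpha> x + \<gamma> e\<^sub>k\<close>, where \<open>k\<close> is the \<^emph>\<open>smallest\<close> index attaining the maximum. This
  oracle reveals the coordinates as slowly as possible: if \<open>x\<close> lies in the span of
  \<open>e\<^sub>1, \<dots>, e\<^sub>s\<^sub>-\<^sub>1\<close>, its coordinates from \<open>s\<close> on are 0, so either the maximum is positive and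
  attained before \<open>s\<close>, or it is 0 and attained at \<open>s\<close> at the latest. Hence each
  answer adds at most the next direction to the span
  (\<open>resisted_query_in_span\<close>), each of the first \<open>t\<close> queries has coordinate \<open>t\<close>
  equal to 0, and \<open>f\<close> is nonnegative there (\<open>resisted_value_nonneg\<close>).

  On the other hand, bounding the maximum below by the average and completing the
  square shows that the global minimum of \<open>f\<close> is \<open>- \<gamma>\<^sup>2/(2\<alpha>t)\<close>, attained at the
  point with all \<open>t\<close> coordinates equal to \<open>- \<gamma>/(\<alpha>t)\<close>, whose norm is \<open>\<gamma>/(\<alpha>\<surd>t)\<close>
  (\<open>resisting_fun_minimizer_le\<close>). So the gap is at least \<open>\<gamma>\<^sup>2/(2\<alpha>t)\<close> as soon as
  the ball contains this point.

  Every subgradient of \<open>f\<close> at \<open>x\<close> is \<open>\<alpha> x\<close> plus a subgradient of \<open>\<gamma> max\<^sub>i (e\<^sub>i \<bullet> x)\<close>,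
  which has norm at most \<open>\<gamma>\<close>; so \<open>f\<close> is \<open>L\<close>-Lipschitz on the ball of radius \<open>\<rho>\<close> if
  \<open>\<gamma> + \<alpha> \<rho> \<le> L\<close>. In (a) the two constraints are both tight for
  \<open>\<gamma> = L\<surd>t/(1+\<surd>t)\<close> and \<open>\<alpha> = L/(R(1+\<surd>t))\<close>. In (b), \<open>\<alpha>\<close> is given,
  \<open>\<rho> = L/(2\<alpha>)\<close> and \<open>\<gamma> = L/2\<close>.
\<close>

section \<open>Subgradients\<close>

text \<open>
  The affine minorant of \<open>f\<close> that touches it at a point \<open>z\<close> between \<open>x\<close> and \<open>y\<close> lies below
  \<open>f\<close> at both ends, so the chord lies above \<open>f z\<close>.
\<close>

lemma convex_on_if_first_order_oracle:
  assumes "first_order_oracle f orc"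
  shows "convex_on UNIV f"
proof (rule convex_onI)
  fix u :: real and x y :: 'a
  assume u: "0 < u" "u < 1"
  define z where "z = (1 - u) *\<^sub>R x + u *\<^sub>R y"
  have sub: "f z - f w \<le> orc z \<bullet> (z - w)" for w
    using assms by (simp add: first_order_oracle_def subdifferential_def)
  have "(1 - u) * (f z - f x) + u * (f z - f y)
      \<le> (1 - u) * (orc z \<bullet> (z - x)) + u * (orc z \<bullet> (z - y))"
    using u sub by (intro add_mono mult_left_mono) auto
  also have "\<dots> = orc z \<bullet> ((1 - u) *\<^sub>R (z - x) + u *\<^sub>R (z - y))"
    by (simp add: inner_add_right)
  also have "(1 - u) *\<^sub>R (z - x) + u *\<^sub>R (z - y) = 0"
    by (simp add: z_def algebra_simps)
  finally show "f ((1 - u) *\<^sub>R x + u *\<^sub>R y) \<le> (1 - u) * f x + u * f y"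
    by (simp add: z_def algebra_simps)
qed simp

text \<open>Moving from \<open>x\<close> by \<open>g\<close> raises \<open>h\<close> by at least \<open>\<parallel>g\<parallel>\<^sup>2\<close>, and by at most \<open>\<gamma> \<parallel>g\<parallel>\<close>.\<close>

lemma norm_subgradient_le:
  assumes "0 \<le> \<gamma>" and lip: "\<And>y. h y - h x \<le> \<gamma> * norm (y - x)" and g: "g \<in> subdifferential h x"
  shows "norm g \<le> \<gamma>"
proof (cases "g = 0")
  case True
  then show ?thesis using assms(1) by simp
next
  case False
  have "h x - h (x + g) \<le> g \<bullet> (x - (x + g))"
    using g unfolding subdifferential_def by blast
  then have "norm g * norm g \<le> \<gamma> * norm g"
    using lip[of "x + g"] by (simp add: dot_square_norm power2_eq_square)
  then show ?thesis using False by simp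
qed

text \<open>
  If \<open>g\<close> is a subgradient of \<open>h + \<alpha>/2 \<parallel>\<cdot>\<parallel>\<^sup>2\<close> at \<open>x\<close>, the inequality expressing that
  \<open>g - \<alpha> x\<close> is a subgradient of \<open>h\<close> fails at \<open>y\<close> by at most \<open>\<alpha>/2 \<parallel>x - y\<parallel>\<^sup>2\<close>.
  Replacing \<open>y\<close> by the point at the fraction \<open>s\<close> of the way from \<open>x\<close> to \<open>y\<close> scales
  this error by \<open>s\<^sup>2\<close>, while by convexity of \<open>h\<close> a failure scales at least by \<open>s\<close>; so
  letting \<open>s\<close> tend to 0 excludes a failure.
\<close>

lemma subdifferential_add_quadratic:
  fixes h :: "'a::real_inner \<Rightarrow> real"
  assumes conv: "convex_on UNIV h" and "0 \<le> \<alpha>"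
  shows "g \<in> subdifferential (\<lambda>x. h x + \<alpha> / 2 * (norm x)\<^sup>2) x
           \<longleftrightarrow> g - \<alpha> *\<^sub>R x \<in> subdifferential h x"
proof
  assume g: "g \<in> subdifferential (\<lambda>x. h x + \<alpha> / 2 * (norm x)\<^sup>2) x"
  have "h x - h y \<le> (g - \<alpha> *\<^sub>R x) \<bullet> (x - y)" for y
  proof (rule ccontr)
    define d where "d = h x - h y - (g - \<alpha> *\<^sub>R x) \<bullet> (x - y)"
    define K where "K = \<alpha> / 2 * (norm (x - y))\<^sup>2"
    assume "\<not> ?thesis"
    then have "d > 0" by (simp add: d_def)
    have "K \<ge> 0" using \<open>0 \<le> \<alpha>\<close> by (simp add: K_def)
    have small: "d \<le> s * K" if s: "0 < s" "s < 1" for s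
    proof -
      define z where "z = (1 - s) *\<^sub>R x + s *\<^sub>R y"
      have xz: "x - z = s *\<^sub>R (x - y)" by (simp add: z_def algebra_simps)
      have z: "z = x - s *\<^sub>R (x - y)" by (simp add: z_def algebra_simps)
      have nz: "(norm z)\<^sup>2 = (norm x)\<^sup>2 - 2 * s * (x \<bullet> (x - y)) + s\<^sup>2 * (norm (x - y))\<^sup>2"
        unfolding z power2_norm_eq_inner
        by (simp add: inner_diff_left inner_diff_right inner_commute algebra_simps power2_eq_square)
      have "h z \<le> (1 - s) * h x + s * h y"
        unfolding z_def using convex_onD[OF conv, of s x y] s by simp
      then have "s * (h x - h y) \<le> h x - h z" by (simp add: algebra_simps)
      also have "\<dots> \<le> g \<bullet> (x - z) - \<alpha> / 2 * ((norm x)\<^sup>2 - (norm z)\<^sup>2)"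
      proof -
        have "(h x + \<alpha> / 2 * (norm x)\<^sup>2) - (h z + \<alpha> / 2 * (norm z)\<^sup>2) \<le> g \<bullet> (x - z)"
          using g unfolding subdifferential_def by blast
        then show ?thesis by (simp add: algebra_simps)
      qed
      also have "\<dots> = s * (g \<bullet> (x - y)) - s * \<alpha> * (x \<bullet> (x - y)) + s * s * K"
        unfolding xz nz K_def by (simp add: algebra_simps power2_eq_square)
      finally have "s * d \<le> s * (s * K)"
        by (simp add: d_def inner_diff_left algebra_simps)
      then show ?thesis using s by simp
    qed
    define s where "s = d / (2 * (K + d))"
    have "0 < s" "s < 1" using \<open>d > 0\<close> \<open>K \<ge> 0\<close> by (auto simp: s_def divide_simps)
    then have "d \<le> s * K" by (rule small)
    also have "\<dots> \<le> s * (K + d)" using \<open>0 < s\<close> \<open>d > 0\<close> by simp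
    also have "\<dots> = d / 2"
    proof -
      have "K + d \<noteq> 0" using \<open>d > 0\<close> \<open>K \<ge> 0\<close> by simp
      then show ?thesis unfolding s_def by (simp add: divide_simps)
    qed
    finally show False using \<open>d > 0\<close> by simp
  qed
  then show "g - \<alpha> *\<^sub>R x \<in> subdifferential h x" by (simp add: subdifferential_def)
next
  assume g: "g - \<alpha> *\<^sub>R x \<in> subdifferential h x"
  have "h x + \<alpha> / 2 * (norm x)\<^sup>2 - (h y + \<alpha> / 2 * (norm y)\<^sup>2) \<le> g \<bullet> (x - y)" for y
  proof -
    have "h x - h y \<le> (g - \<alpha> *\<^sub>R x) \<bullet> (x - y)"
      using g by (simp add: subdifferential_def)
    moreover have "\<alpha> / 2 * (norm x)\<^sup>2 - \<alpha> / 2 * (norm y)\<^sup>2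
        = \<alpha> * (x \<bullet> (x - y)) - \<alpha> / 2 * (norm (x - y))\<^sup>2"
      unfolding power2_norm_eq_inner
      by (simp add: inner_diff_left inner_diff_right inner_commute algebra_simps)
    moreover have "0 \<le> \<alpha> / 2 * (norm (x - y))\<^sup>2" using \<open>0 \<le> \<alpha>\<close> by simp
    ultimately show ?thesis by (simp add: inner_diff_left)
  qed
  then show "g \<in> subdifferential (\<lambda>x. h x + \<alpha> / 2 * (norm x)\<^sup>2) x"
    by (simp add: subdifferential_def)
qed

text \<open>
  By the decomposition of subgradients, the subgradient inequality for \<open>h\<close> suffices, and
  the quadratic term improves on its own subgradient inequality by exactly \<open>\<alpha>/2 \<parallel>x - y\<parallel>\<^sup>2\<close>.
\<close>

lemma strongly_convex_add_quadratic:
  fixes h :: "'a::real_inner \<Rightarrow> real"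
  assumes "convex_on UNIV h" and "0 \<le> \<alpha>"
  shows "strongly_convex \<alpha> (\<lambda>x. h x + \<alpha> / 2 * (norm x)\<^sup>2)"
  unfolding strongly_convex_def
proof (intro allI ballI)
  fix x y g
  assume "g \<in> subdifferential (\<lambda>x. h x + \<alpha> / 2 * (norm x)\<^sup>2) x"
  then have "g - \<alpha> *\<^sub>R x \<in> subdifferential h x"
    using subdifferential_add_quadratic[OF assms] by blast
  then have "h x - h y \<le> (g - \<alpha> *\<^sub>R x) \<bullet> (x - y)" by (simp add: subdifferential_def)
  moreover have "\<alpha> / 2 * (norm x)\<^sup>2 - \<alpha> / 2 * (norm y)\<^sup>2
      = \<alpha> * (x \<bullet> (x - y)) - \<alpha> / 2 * (norm (x - y))\<^sup>2"
    unfolding power2_norm_eq_inner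
    by (simp add: inner_diff_left inner_diff_right inner_commute algebra_simps)
  ultimately show "h x + \<alpha> / 2 * (norm x)\<^sup>2 - (h y + \<alpha> / 2 * (norm y)\<^sup>2)
      \<le> g \<bullet> (x - y) - \<alpha> / 2 * (norm (x - y))\<^sup>2"
    by (simp add: inner_diff_left)
qed

section \<open>The resisting function\<close>

locale resisting_function =
  fixes e :: "nat \<Rightarrow> 'a::real_inner" and t :: nat and \<alpha> \<gamma> :: real
  assumes t: "1 \<le> t"
    and orthonormal: "\<And>i j. i \<in> {1..t} \<Longrightarrow> j \<in> {1..t} \<Longrightarrow> e i \<bullet> e j = (if i = j then 1 else 0)"
    and alpha: "0 < \<alpha>" and gamma: "0 < \<gamma>"
begin

definition coord_max :: "'a \<Rightarrow> real" where
  "coord_max x = (MAX i\<in>{1..t}. e i \<bullet> x)"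

definition first_max :: "'a \<Rightarrow> nat" where
  "first_max x = (LEAST i. i \<in> {1..t} \<and> e i \<bullet> x = coord_max x)"

definition resisting_fun :: "'a \<Rightarrow> real" where
  "resisting_fun x = \<gamma> * coord_max x + \<alpha> / 2 * (norm x)\<^sup>2"

definition answer :: "'a \<Rightarrow> 'a" where
  "answer x = \<alpha> *\<^sub>R x + \<gamma> *\<^sub>R e (first_max x)"

definition minimizer :: 'a where
  "minimizer = - (\<gamma> / (\<alpha> * real t)) *\<^sub>R (\<Sum>i=1..t. e i)"

lemma coord_le_max: "i \<in> {1..t} \<Longrightarrow> e i \<bullet> x \<le> coord_max x"
  unfolding coord_max_def by (rule Max_ge) auto

lemma first_max: "first_max x \<in> {1..t}" "e (first_max x) \<bullet> x = coord_max x"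
proof -
  have "coord_max x \<in> (\<lambda>i. e i \<bullet> x) ` {1..t}"
    unfolding coord_max_def using t by (intro Max_in) auto
  then have "\<exists>i. i \<in> {1..t} \<and> e i \<bullet> x = coord_max x" by auto
  then have "first_max x \<in> {1..t} \<and> e (first_max x) \<bullet> x = coord_max x"
    unfolding first_max_def by (rule LeastI_ex)
  then show "first_max x \<in> {1..t}" "e (first_max x) \<bullet> x = coord_max x" by auto
qed

lemma first_max_le: "i \<in> {1..t} \<Longrightarrow> e i \<bullet> x = coord_max x \<Longrightarrow> first_max x \<le> i"
  unfolding first_max_def by (rule Least_le) simp

lemma norm_e: "i \<in> {1..t} \<Longrightarrow> norm (e i) = 1"
  using orthonormal[of i i] by (simp add: norm_eq_sqrt_inner)

text \<open>
  Besides yielding the oracle of the whole function, this gives the convexity of the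
  maximum term, since a function with a subgradient at every point is convex.
\<close>

lemma first_order_oracle_coord_max:
  "first_order_oracle (\<lambda>x. \<gamma> * coord_max x) (\<lambda>x. \<gamma> *\<^sub>R e (first_max x))"
  unfolding first_order_oracle_def subdifferential_def
proof (intro allI CollectI)
  fix x y
  have "e (first_max x) \<bullet> y \<le> coord_max y" using first_max(1) by (rule coord_le_max)
  then have "coord_max x - coord_max y \<le> e (first_max x) \<bullet> (x - y)"
    by (simp add: inner_diff_right first_max(2))
  then show "\<gamma> * coord_max x - \<gamma> * coord_max y \<le> (\<gamma> *\<^sub>R e (first_max x)) \<bullet> (x - y)"
    using gamma by (simp flip: right_diff_distrib)
qed

lemmas convex_coord_max = convex_on_if_first_order_oracle[OF first_order_oracle_coord_max]

lemma coord_max_lipschitz: "\<gamma> * coord_max y - \<gamma> * coord_max x \<le> \<gamma> * norm (y - x)"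
proof -
  have "e (first_max y) \<bullet> x \<le> coord_max x" using first_max(1) by (rule coord_le_max)
  then have "coord_max y - coord_max x \<le> e (first_max y) \<bullet> (y - x)"
    by (simp add: inner_diff_right first_max(2))
  also have "\<dots> \<le> norm (e (first_max y)) * norm (y - x)" by (rule norm_cauchy_schwarz)
  also have "\<dots> = norm (y - x)" using norm_e first_max(1) by simp
  finally show ?thesis using gamma by (simp flip: right_diff_distrib)
qed

lemmas subdifferential_resisting_fun =
  subdifferential_add_quadratic[OF convex_coord_max less_imp_le[OF alpha],
    folded resisting_fun_def]

lemma first_order_oracle_answer: "first_order_oracle resisting_fun answer"
  using first_order_oracle_coord_max
  by (simp add: first_order_oracle_def subdifferential_resisting_fun answer_def)

lemma strongly_convex_resisting_fun: "strongly_convex \<alpha> resisting_fun"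
  using strongly_convex_add_quadratic[OF convex_coord_max less_imp_le[OF alpha],
    folded resisting_fun_def] .

lemma subgradient_lipschitz_resisting_fun:
  assumes "\<gamma> + \<alpha> * \<rho> \<le> L"
  shows "subgradient_lipschitz_on L (cball 0 \<rho>) resisting_fun"
  unfolding subgradient_lipschitz_on_def
proof (intro ballI)
  fix x g
  assume x: "x \<in> cball 0 \<rho>" and "g \<in> subdifferential resisting_fun x"
  then have "norm (g - \<alpha> *\<^sub>R x) \<le> \<gamma>"
    using gamma coord_max_lipschitz
    by (intro norm_subgradient_le[of _ "\<lambda>x. \<gamma> * coord_max x" x])
      (auto simp: subdifferential_resisting_fun)
  moreover have "norm g \<le> norm (g - \<alpha> *\<^sub>R x) + norm (\<alpha> *\<^sub>R x)"
    by (metis add.commute norm_triangle_sub)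
  moreover have "norm (\<alpha> *\<^sub>R x) \<le> \<alpha> * \<rho>"
    using x alpha by simp
  ultimately show "norm g \<le> L" using assms by simp
qed

section \<open>The minimum of the resisting function\<close>

lemma inner_sum_e: "i \<in> {1..t} \<Longrightarrow> e i \<bullet> (\<Sum>j=1..t. e j) = 1"
  by (simp add: inner_sum_right orthonormal)

lemma inner_sum_sum_e: "(\<Sum>i=1..t. e i) \<bullet> (\<Sum>j=1..t. e j) = real t"
proof -
  have "(\<Sum>i=1..t. e i) \<bullet> (\<Sum>j=1..t. e j) = (\<Sum>i=1..t. e i \<bullet> (\<Sum>j=1..t. e j))"
    by (rule inner_sum_left)
  also have "\<dots> = (\<Sum>i=1..t. 1)" by (intro sum.cong refl inner_sum_e)
  finally show ?thesis by simp
qed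

lemma norm_minimizer: "norm minimizer = \<gamma> / (\<alpha> * sqrt (real t))"
proof -
  have "norm (\<Sum>i=1..t. e i) = sqrt (real t)"
    by (simp only: norm_eq_sqrt_inner inner_sum_sum_e)
  then have "norm minimizer = \<gamma> / (\<alpha> * real t) * sqrt (real t)"
    using alpha gamma by (simp add: minimizer_def)
  also have "\<dots> = \<gamma> / (\<alpha> * (sqrt (real t) * sqrt (real t))) * sqrt (real t)" by simp
  also have "\<dots> = \<gamma> / (\<alpha> * sqrt (real t))" using t by (simp del: real_sqrt_mult_self)
  finally show ?thesis .
qed

lemma resisting_fun_minimizer: "resisting_fun minimizer = - \<gamma>\<^sup>2 / (2 * \<alpha> * real t)"
proof -
  have "coord_max minimizer = e (first_max minimizer) \<bullet> minimizer" by (simp add: first_max(2))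
  also have "\<dots> = - (\<gamma> / (\<alpha> * real t))"
    using inner_sum_e[OF first_max(1)] by (simp add: minimizer_def)
  finally have coord: "coord_max minimizer = - (\<gamma> / (\<alpha> * real t))" .
  have norm: "(norm minimizer)\<^sup>2 = \<gamma>\<^sup>2 / (\<alpha>\<^sup>2 * real t)"
    by (simp add: norm_minimizer power_divide power_mult_distrib)
  show ?thesis
    unfolding resisting_fun_def coord norm
    using t alpha by (simp add: field_simps power2_eq_square)
qed

text \<open>
  With \<open>u = e\<^sub>1 + \<dots> + e\<^sub>t\<close>, the value at \<open>x\<close> is at least
  \<open>\<gamma>/t (u \<bullet> x) + \<alpha>/2 \<parallel>x\<parallel>\<^sup>2 = \<alpha>/2 \<parallel>x + \<gamma>/(\<alpha>t) u\<parallel>\<^sup>2 - \<gamma>\<^sup>2/(2\<alpha>t)\<close>,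
  because a maximum is at least the average.
\<close>

lemma resisting_fun_minimizer_le: "resisting_fun minimizer \<le> resisting_fun x"
proof -
  define u where "u = (\<Sum>i=1..t. e i)"
  define c where "c = \<gamma> / (\<alpha> * real t)"
  have gc: "\<gamma> = \<alpha> * c * real t" using t alpha by (simp add: c_def)
  have "u \<bullet> x = (\<Sum>i=1..t. e i \<bullet> x)" by (simp add: u_def inner_sum_left)
  also have "\<dots> \<le> (\<Sum>i=1..t. coord_max x)" by (intro sum_mono coord_le_max)
  finally have "u \<bullet> x \<le> real t * coord_max x" by simp
  then have "\<alpha> * c * (u \<bullet> x) \<le> \<alpha> * c * (real t * coord_max x)"
    using alpha gamma by (intro mult_left_mono) (auto simp: c_def)
  then have avg: "\<alpha> * c * (u \<bullet> x) \<le> \<gamma> * coord_max x" by (simp add: gc mult.assoc)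
  have "(norm (x + c *\<^sub>R u))\<^sup>2 = (norm x)\<^sup>2 + 2 * c * (u \<bullet> x) + c\<^sup>2 * real t"
    unfolding power2_norm_eq_inner
    by (simp add: inner_add_left inner_add_right inner_commute algebra_simps power2_eq_square
        inner_sum_sum_e[folded u_def])
  then have "0 \<le> \<alpha> / 2 * ((norm x)\<^sup>2 + 2 * c * (u \<bullet> x) + c\<^sup>2 * real t)"
    using alpha by (metis half_gt_zero less_imp_le mult_nonneg_nonneg zero_le_power2)
  then have "- (\<alpha> / 2 * c\<^sup>2 * real t) \<le> \<alpha> * c * (u \<bullet> x) + \<alpha> / 2 * (norm x)\<^sup>2"
    by (simp add: algebra_simps)
  also have "\<dots> \<le> resisting_fun x" using avg by (simp add: resisting_fun_def)
  finally have "- (\<alpha> / 2 * c\<^sup>2 * real t) \<le> resisting_fun x" .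
  moreover have "resisting_fun minimizer = - (\<alpha> / 2 * c\<^sup>2 * real t)"
    using t alpha by (simp add: resisting_fun_minimizer c_def field_simps power2_eq_square)
  ultimately show ?thesis by simp
qed

lemma is_arg_min_minimizer:
  assumes "\<gamma> / (\<alpha> * sqrt (real t)) \<le> \<rho>"
  shows "is_arg_min resisting_fun (\<lambda>x. x \<in> cball 0 \<rho>) minimizer"
  using assms resisting_fun_minimizer_le
  by (auto simp: is_arg_min_linorder norm_minimizer)

section \<open>Procedures under the span condition\<close>

lemma inner_span_eq_0:
  assumes "x \<in> span (e ` {1..<s})" and "s \<in> {1..t}"
  shows "e s \<bullet> x = 0"
proof -
  have "orthogonal (e s) x"
  proof (rule orthogonal_to_span[OF assms(1)])
    fix y assume "y \<in> e ` {1..<s}"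
    then show "orthogonal (e s) y" using assms(2) by (auto simp: orthogonal_def orthonormal)
  qed
  then show ?thesis by (simp add: orthogonal_def)
qed

text \<open>
  The coordinate \<open>e\<^sub>i \<bullet> x\<close> vanishes for \<open>s \<le> i \<le> t\<close>. So a maximum first attained after \<open>s\<close>
  would have the value 0, which is attained at \<open>s\<close> already.
\<close>

lemma first_max_le_of_span:
  assumes x: "x \<in> span (e ` {1..<s})" and s: "s \<in> {1..t}"
  shows "first_max x \<le> s"
proof (rule ccontr)
  assume later: "\<not> first_max x \<le> s"
  have "span (e ` {1..<s}) \<subseteq> span (e ` {1..<first_max x})"
    using later by (intro span_mono image_mono) auto
  then have "e (first_max x) \<bullet> x = 0"
    using x first_max(1) by (intro inner_span_eq_0) auto
  then have "e s \<bullet> x = coord_max x"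
    using inner_span_eq_0[OF x s] first_max(2) by simp
  then show False using first_max_le[OF s] later by simp
qed

lemma answer_in_span:
  assumes x: "x \<in> span (e ` {1..<s})" and s: "s \<in> {1..t}"
  shows "answer x \<in> span (e ` {1..s})"
proof -
  have "span (e ` {1..<s}) \<subseteq> span (e ` {1..s})" by (intro span_mono image_mono) auto
  moreover have "e (first_max x) \<in> span (e ` {1..s})"
    using first_max(1) first_max_le_of_span[OF assms] by (intro span_base imageI) auto
  ultimately show ?thesis
    unfolding answer_def using x by (intro span_add span_scale) auto
qed

lemma resisted_query_in_span:
  assumes A: "span_condition A answer" and "s \<in> {1..t}"
  shows "query A answer s \<in> span (e ` {1..<s})"
  using assms(2)
proof (induction s rule: less_induct)
  case (less s)
  show ?case
  proof (cases "s = 1")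
    case True
    then show ?thesis using A by (simp add: span_condition_def span_zero)
  next
    case False
    define r where "r = s - 1"
    have r: "s = r + 1" "1 \<le> r" using False less.prems by (auto simp: r_def)
    have "answer (query A answer j) \<in> span (e ` {1..<s})" if "j \<in> {1..r}" for j
    proof -
      have "answer (query A answer j) \<in> span (e ` {1..j})"
        using that r less by (intro answer_in_span) auto
      moreover have "span (e ` {1..j}) \<subseteq> span (e ` {1..<s})"
        using that r by (intro span_mono image_mono) auto
      ultimately show ?thesis by blast
    qed
    then have "span ((\<lambda>j. answer (query A answer j)) ` {1..r}) \<subseteq> span (e ` {1..<s})"
      by (intro span_minimal subspace_span) auto
    then show ?thesis using A r by (auto simp: span_condition_def)
  qed
qed

lemma resisted_value_nonneg:
  assumes "span_condition A answer" and s: "s \<in> {1..t}"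
  shows "0 \<le> resisting_fun (query A answer s)"
proof -
  have "0 \<le> coord_max (query A answer s)"
    using coord_le_max[OF s] inner_span_eq_0[OF resisted_query_in_span[OF assms] s] by metis
  then show ?thesis using alpha gamma by (simp add: resisting_fun_def)
qed

lemma resisting_gap:
  assumes "span_condition A answer"
  shows "\<gamma>\<^sup>2 / (2 * \<alpha> * real t)
    \<le> (MIN s\<in>{1..t}. resisting_fun (query A answer s)) - resisting_fun minimizer"
proof -
  have "0 \<le> (MIN s\<in>{1..t}. resisting_fun (query A answer s))"
    using t resisted_value_nonneg[OF assms] by (subst Min_ge_iff) auto
  then show ?thesis by (simp add: resisting_fun_minimizer)
qed

end

section \<open>The lower bounds\<close>

theorem theorem3p13:
  fixes t :: nat and L R :: real
  assumes "1 \<le> t" and "t \<le> CARD('n::finite)" and "L > 0" and "R > 0"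
  shows
    "(\<exists>(f :: real ^ 'n \<Rightarrow> real) orc xmin.
        convex_on UNIV f \<and>
        subgradient_lipschitz_on L (cball 0 R) f \<and>
        first_order_oracle f orc \<and>
        is_arg_min f (\<lambda>x. x \<in> cball 0 R) xmin \<and>
        (\<forall>A. span_condition A orc \<longrightarrow>
           (MIN s\<in>{1..t}. f (query A orc s)) - f xmin \<ge> R * L / (2 * (1 + sqrt (real t)))))
     \<and>
     (\<forall>\<alpha>>0. \<exists>(f :: real ^ 'n \<Rightarrow> real) orc xmin.
        strongly_convex \<alpha> f \<and>
        subgradient_lipschitz_on L (cball 0 (L / (2 * \<alpha>))) f \<and>
        first_order_oracle f orc \<and>
        is_arg_min f (\<lambda>x. x \<in> cball 0 (L / (2 * \<alpha>))) xmin \<and>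
        (\<forall>A. span_condition A orc \<longrightarrow>
           (MIN s\<in>{1..t}. f (query A orc s)) - f xmin \<ge> L\<^sup>2 / (8 * \<alpha> * real t)))"
proof -
  obtain b :: "nat \<Rightarrow> 'n" where "bij_betw b {0..<CARD('n)} UNIV"
    using ex_bij_betw_nat_finite[OF finite, of "UNIV :: 'n set"] by blast
  then have inj: "inj_on b {0..<CARD('n)}" by (rule bij_betw_imp_inj_on)
  \<comment> \<open>\<open>b\<close> numbers the coordinates from 0, the queries and the vectors \<open>e\<^sub>i\<close> from 1.\<close>
  define e :: "nat \<Rightarrow> real ^ 'n" where "e i = axis (b (i - 1)) 1" for i
  have orthonormal: "e i \<bullet> e j = (if i = j then 1 else 0)" if "i \<in> {1..t}" "j \<in> {1..t}" for i j
  proof -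
    have "b (i - 1) = b (j - 1) \<longleftrightarrow> i = j"
      using that assms(2) inj_on_eq_iff[OF inj, of "i - 1" "j - 1"] by force
    then show ?thesis by (simp add: e_def inner_axis_axis)
  qed
  define q where "q = sqrt (real t)"
  have q: "1 \<le> q" "q\<^sup>2 = real t" using \<open>1 \<le> t\<close> by (auto simp: q_def)
  show ?thesis
  proof (intro conjI allI impI)
    define \<alpha> \<gamma> where "\<alpha> = L / (R * (1 + q))" and "\<gamma> = L * q / (1 + q)"
    interpret resisting_function e t \<alpha> \<gamma>
      using assms q orthonormal by unfold_locales (auto simp: \<alpha>_def \<gamma>_def)
    have lip: "\<gamma> + \<alpha> * R \<le> L"
    proof -
      have "\<alpha> * R = L / (1 + q)" using \<open>R > 0\<close> by (simp add: \<alpha>_def)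
      then have "\<gamma> + \<alpha> * R = L * (1 + q) / (1 + q)"
        by (simp add: \<gamma>_def add_divide_distrib distrib_left)
      then show ?thesis using q by simp
    qed
    have radius: "\<gamma> / (\<alpha> * sqrt (real t)) \<le> R"
    proof -
      have "1 + q \<noteq> 0" "q \<noteq> 0" using q by auto
      then have "\<gamma> / (\<alpha> * q) = R"
        unfolding \<alpha>_def \<gamma>_def using assms by (simp add: divide_simps)
      then show ?thesis by (simp add: q_def)
    qed
    have gap: "\<gamma>\<^sup>2 / (2 * \<alpha> * real t) = R * L / (2 * (1 + sqrt (real t)))"
    proof -
      have "1 + q \<noteq> 0" "q \<noteq> 0" using q by auto
      then have "\<gamma>\<^sup>2 / (2 * \<alpha> * q\<^sup>2) = R * L / (2 * (1 + q))"
        unfolding \<alpha>_def \<gamma>_def using assms by (simp add: divide_simps power2_eq_square)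
      then show ?thesis unfolding q(2) unfolding q_def .
    qed
    show "\<exists>(f :: real ^ 'n \<Rightarrow> real) orc xmin.
        convex_on UNIV f \<and>
        subgradient_lipschitz_on L (cball 0 R) f \<and>
        first_order_oracle f orc \<and>
        is_arg_min f (\<lambda>x. x \<in> cball 0 R) xmin \<and>
        (\<forall>A. span_condition A orc \<longrightarrow>
           (MIN s\<in>{1..t}. f (query A orc s)) - f xmin \<ge> R * L / (2 * (1 + sqrt (real t))))"
      using convex_on_if_first_order_oracle[OF first_order_oracle_answer]
        subgradient_lipschitz_resisting_fun[OF lip] first_order_oracle_answer
        is_arg_min_minimizer[OF radius] resisting_gap[unfolded gap]
      by blast
  next
    fix \<alpha> :: real assume "\<alpha> > 0"
    interpret resisting_function e t \<alpha> "L / 2"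
      using assms \<open>\<alpha> > 0\<close> orthonormal by unfold_locales auto
    have lip: "L / 2 + \<alpha> * (L / (2 * \<alpha>)) \<le> L" using \<open>\<alpha> > 0\<close> by simp
    have radius: "L / 2 / (\<alpha> * sqrt (real t)) \<le> L / (2 * \<alpha>)"
      unfolding q_def[symmetric] using assms q \<open>\<alpha> > 0\<close> by (simp add: divide_simps)
    have gap: "(L / 2)\<^sup>2 / (2 * \<alpha> * real t) = L\<^sup>2 / (8 * \<alpha> * real t)"
      by (simp add: power_divide)
    show "\<exists>(f :: real ^ 'n \<Rightarrow> real) orc xmin.
        strongly_convex \<alpha> f \<and>
        subgradient_lipschitz_on L (cball 0 (L / (2 * \<alpha>))) f \<and>
        first_order_oracle f orc \<and>
        is_arg_min f (\<lambda>x. x \<in> cball 0 (L / (2 * \<alpha>))) xmin \<and>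
        (\<forall>A. span_condition A orc \<longrightarrow>
           (MIN s\<in>{1..t}. f (query A orc s)) - f xmin \<ge> L\<^sup>2 / (8 * \<alpha> * real t))"
      using strongly_convex_resisting_fun
        subgradient_lipschitz_resisting_fun[OF lip] first_order_oracle_answer
        is_arg_min_minimizer[OF radius] resisting_gap[unfolded gap]
      by blast
  qed
qed

end
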